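(* Consider the binary-input CDMA channel described in the context with i.i.d. standard Gaussian spreading coefficients $s_{ik}\sim\mathcal N(0,1)$ and arbitrary input distribution $p_X$ on $\{\pm1\}^K$. Given $\epsilon>0$, there exists an integer $K_1=O(|\ln\epsilon|)$, independent of $p_X$, such that for all $K>K_1$, $$\mathbb P\bigl[\,|I(X;Y)-\mathbb E_S[I(X;Y)]|\ge \epsilon K\,\bigr]\le 3e^{-\alpha_1\epsilon^2K},$$ where $\alpha_1=\frac{1}{16}\sigma^4(64\beta+32+\sigma^2)^{-1}$ and the probability is over the spreading matrix.
   Context: CDMA model: $K$ users, $N$ chips, $K/N=\beta$ fixed. Spreading matrix $s=(s_{ik})$ is $N\times K$. Inputs $x\in\{\pm1\}^K$ with distribution $p_X$. Output $y_i=N^{-1/2}\sum_{k=1}^K s_{ik}x_k+\sigma n_i$, $i=1,\dots,N$, with $n_i$ i.i.d. $\mathcal N(0,1)$ independent of everything, $\sigma^2>0$. $I(X;Y)$ is the mutual information between input and output for the given realization of the spreading matrix (a random variable as a function of the spreading matrix), and $\mathbb E_S$ is expectation over the spreading matrix. *)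

theory Defs
  imports "HOL-Probability.Probability" "HOL-Library.Landau_Symbols"
begin

definition sign_vectors :: "nat \<Rightarrow> (nat \<Rightarrow> real) set" where
  "sign_vectors K = PiE {..<K} (\<lambda>_. {-1, 1})"

definition spreading_measure :: "nat \<Rightarrow> nat \<Rightarrow> (nat \<times> nat \<Rightarrow> real) measure" where
  "spreading_measure N K =
     PiM ({..<N} \<times> {..<K}) (\<lambda>_. density lborel std_normal_density)"

definition output_space :: "nat \<Rightarrow> (nat \<Rightarrow> real) measure" where
  "output_space N = PiM {..<N} (\<lambda>_. lborel)"

text \<open>Conditional density of y given x:
  y_i = N^(-1/2) * sum_k s_ik x_k + sigma n_i, n_i i.i.d. N(0,1).\<close>
definition cdma_cond_density ::
    "real \<Rightarrow> nat \<Rightarrow> nat \<Rightarrow> (nat \<times> nat \<Rightarrow> real) \<Rightarrow> (nat \<Rightarrow> real) \<Rightarrow> (nat \<Rightarrow> real) \<Rightarrow> real" where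
  "cdma_cond_density \<sigma> N K s x y =
     (\<Prod>i<N. normal_density ((\<Sum>k<K. s (i, k) * x k) / sqrt (real N)) \<sigma> (y i))"

definition cdma_out_density ::
    "real \<Rightarrow> nat \<Rightarrow> nat \<Rightarrow> (nat \<times> nat \<Rightarrow> real) \<Rightarrow> (nat \<Rightarrow> real) pmf \<Rightarrow> (nat \<Rightarrow> real) \<Rightarrow> real" where
  "cdma_out_density \<sigma> N K s pX y =
     measure_pmf.expectation pX (\<lambda>x. cdma_cond_density \<sigma> N K s x y)"

definition cdma_mutual_info ::
    "real \<Rightarrow> nat \<Rightarrow> nat \<Rightarrow> (nat \<times> nat \<Rightarrow> real) \<Rightarrow> (nat \<Rightarrow> real) pmf \<Rightarrow> real" where
  "cdma_mutual_info \<sigma> N K s pX =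
     measure_pmf.expectation pX (\<lambda>x.
        \<integral>y. cdma_cond_density \<sigma> N K s x y *
             ln (cdma_cond_density \<sigma> N K s x y / cdma_out_density \<sigma> N K s pX y)
          \<partial>(output_space N))"

end

theory Submission
  imports Defs
begin

text \<open>
  The mutual information is Lipschitz in each single spreading coefficient, with constant
  \<open>1 / (\<sigma> sqrt N)\<close>. Since \<open>I(X;Y)\<close> is the minimum over output densities \<open>q\<close> of the mean divergence of
  \<open>p(\<cdot>|x)\<close> from \<open>q\<close>, the information after perturbing one coefficient is bounded by using the
  unperturbed output density for \<open>q\<close>. For binary inputs the perturbation translates \<open>y\<^sub>i\<close> by at
  most \<open>h\<close>, so after undoing the translation Jensen's inequality bounds the increase by
  \<open>(h / \<sigma>) E|n\<^sub>i| + h\<^sup>2 / (2 \<sigma>\<^sup>2)\<close>; subdividing the perturbation removes the quadratic term.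
  A function of \<open>NK\<close> independent standard normals that is \<open>c\<close>-Lipschitz in each of them has
  \<open>E exp (l (F - E F)) \<le> exp (l\<^sup>2 c\<^sup>2 N K)\<close>, one coordinate at a time, and Chernoff's bound gives the
  tail \<open>2 exp (- \<epsilon>\<^sup>2 \<sigma>\<^sup>2 K / 4)\<close>, which is stronger than required; the threshold is \<open>K\<^sub>1 = 0\<close>.
\<close>

section \<open>Concentration for coordinatewise Lipschitz functions of independent normals\<close>

abbreviation std_normal :: "real measure" where
  "std_normal \<equiv> density lborel std_normal_density"

interpretation std_normal: prob_space std_normal
  by (rule prob_space_normal_density) simp

interpretation std_normal_PiM: product_sigma_finite "\<lambda>_. std_normal"
  by unfold_locales

lemma prob_space_std_normal_PiM: "prob_space (PiM I (\<lambda>_. std_normal))"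
  by (intro prob_space_PiM std_normal.prob_space_axioms)

text \<open>Completing the square: tilting the standard normal density by \<open>exp (t * x)\<close>
  gives a multiple of the normal density with mean \<open>t\<close>.\<close>

lemma nn_integral_exp_std_normal:
  "(\<integral>\<^sup>+x. ennreal (exp (t * x)) \<partial>std_normal) = ennreal (exp (t\<^sup>2 / 2))"
proof -
  have eq: "std_normal_density x * exp (t * x) = exp (t\<^sup>2 / 2) * normal_density t 1 x" for x
    by (simp add: normal_density_def exp_add[symmetric] power2_eq_square field_simps)
  have "(\<integral>\<^sup>+x. ennreal (exp (t * x)) \<partial>std_normal) =
      (\<integral>\<^sup>+x. ennreal (exp (t\<^sup>2 / 2)) * ennreal (normal_density t 1 x) \<partial>lborel)"
    by (subst nn_integral_density) (auto simp: ennreal_mult'[symmetric] eq)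
  also have "\<dots> = ennreal (exp (t\<^sup>2 / 2))"
    by (simp add: nn_integral_cmult nn_integral_eq_integral)
  finally show ?thesis .
qed

lemma integrable_abs_std_normal: "integrable std_normal (\<lambda>x. \<bar>x\<bar>)"
  using integrable_normal_moment_abs[of 1 0 1]
  by (subst integrable_density) (auto)

lemma lipschitz_integrable_std_normal:
  fixes f :: "real \<Rightarrow> real"
  assumes [measurable]: "f \<in> borel_measurable borel" and lip: "\<And>a b. \<bar>f a - f b\<bar> \<le> c * \<bar>a - b\<bar>"
  shows "integrable std_normal f"
proof (rule Bochner_Integration.integrable_bound)
  show "integrable std_normal (\<lambda>x. \<bar>f 0\<bar> + c * \<bar>x\<bar>)"
    using integrable_abs_std_normal by auto
  show "AE x in std_normal. norm (f x) \<le> norm (\<bar>f 0\<bar> + c * \<bar>x\<bar>)"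
  proof (rule AE_I2)
    fix x show "norm (f x) \<le> norm (\<bar>f 0\<bar> + c * \<bar>x\<bar>)" using lip[of x 0] by simp
  qed
qed simp

text \<open>Symmetrisation: the centred variable is compared with the difference of two independent
  copies, and the even part of \<open>exp\<close> is monotone in the absolute value.\<close>

lemma lipschitz_mgf_std_normal:
  fixes f :: "real \<Rightarrow> real"
  assumes [measurable]: "f \<in> borel_measurable borel" and lip: "\<And>a b. \<bar>f a - f b\<bar> \<le> c * \<bar>a - b\<bar>"
  shows "(\<integral>\<^sup>+a. ennreal (exp (l * (f a - (\<integral>b. f b \<partial>std_normal)))) \<partial>std_normal) \<le> ennreal (exp (l\<^sup>2 * c\<^sup>2))"
proof -
  let ?E = "\<lambda>a b. ennreal (exp (l * (f a - f b)))"
  let ?G = "\<lambda>a b. ennreal (exp (l * c * (a - b)))"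
  have int: "integrable std_normal f" by (rule lipschitz_integrable_std_normal[OF assms])
  have le: "ennreal (exp (l * (f a - (\<integral>b. f b \<partial>std_normal)))) \<le> (\<integral>\<^sup>+b. ?E a b \<partial>std_normal)" for a
  proof -
    \<comment> \<open>\<open>T\<close> is the mean over \<open>b\<close> of
      \<open>l * (f a - f b)\<close>, so the tangent line of \<open>exp\<close> at \<open>T\<close>,
      evaluated at this variable, integrates to \<open>exp T\<close>. This is Jensen's inequality by
      hand.\<close>
    define T where "T = l * (f a - (\<integral>b. f b \<partial>std_normal))"
    have int': "integrable std_normal (\<lambda>b. 1 + (l * (f a - f b) - T))" using int by auto
    have "ennreal (exp T) = ennreal (\<integral>b. exp T * (1 + (l * (f a - f b) - T)) \<partial>std_normal)"
    proof -
      have "(\<integral>b. (1 + (l * (f a - f b) - T)) \<partial>std_normal) = 1"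
        using int by (simp add: T_def std_normal.prob_space[simplified])
      then show ?thesis by simp
    qed
    \<comment> \<open>Truncation at 0 makes the tangent line nonnegative, so the bound passes to the
      nonnegative integral, where integrability of the exponential need not be discussed.\<close>
    also have "\<dots> \<le> ennreal (\<integral>b. max 0 (exp T * (1 + (l * (f a - f b) - T))) \<partial>std_normal)"
      using int' by (intro ennreal_leI integral_mono integrable_max) auto
    also have "\<dots> = (\<integral>\<^sup>+b. ennreal (max 0 (exp T * (1 + (l * (f a - f b) - T)))) \<partial>std_normal)"
      using int' by (intro nn_integral_eq_integral[symmetric] integrable_max) auto
    also have "\<dots> \<le> (\<integral>\<^sup>+b. ?E a b \<partial>std_normal)"
    proof (intro nn_integral_mono ennreal_leI)
      fix b
      have "exp T * (1 + (l * (f a - f b) - T)) \<le> exp T * exp (l * (f a - f b) - T)"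
        by (intro mult_left_mono exp_ge_add_one_self) auto
      also have "\<dots> = exp (l * (f a - f b))" by (simp add: exp_add[symmetric])
      finally show "max 0 (exp T * (1 + (l * (f a - f b) - T))) \<le> exp (l * (f a - f b))" by simp
    qed
    finally show ?thesis unfolding T_def .
  qed
  have sym: "(\<integral>\<^sup>+a. \<integral>\<^sup>+b. h b a \<partial>std_normal \<partial>std_normal) = (\<integral>\<^sup>+a. \<integral>\<^sup>+b. h a b \<partial>std_normal \<partial>std_normal)"
    if [measurable]: "case_prod h \<in> borel_measurable (borel \<Otimes>\<^sub>M borel)" for h :: "real \<Rightarrow> real \<Rightarrow> ennreal"
  proof -
    interpret pair_sigma_finite std_normal std_normal by unfold_locales
    show ?thesis by (rule Fubini') simp
  qed
  \<comment> \<open>Symmetrising the integrand doubles the double integral, so the pointwise bound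
    \<open>EG\<close> between symmetrised sums can be integrated and the factor 2 cancelled.\<close>
  have add: "(\<integral>\<^sup>+a. \<integral>\<^sup>+b. h a b + h b a \<partial>std_normal \<partial>std_normal) = 2 * (\<integral>\<^sup>+a. \<integral>\<^sup>+b. h a b \<partial>std_normal \<partial>std_normal)"
    if [measurable]: "case_prod h \<in> borel_measurable (borel \<Otimes>\<^sub>M borel)" for h :: "real \<Rightarrow> real \<Rightarrow> ennreal"
  proof -
    have "(\<integral>\<^sup>+a. \<integral>\<^sup>+b. h a b + h b a \<partial>std_normal \<partial>std_normal) =
      (\<integral>\<^sup>+a. (\<integral>\<^sup>+b. h a b \<partial>std_normal) + (\<integral>\<^sup>+b. h b a \<partial>std_normal) \<partial>std_normal)"
      by (intro nn_integral_cong nn_integral_add) auto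
    also have "\<dots> = (\<integral>\<^sup>+a. \<integral>\<^sup>+b. h a b \<partial>std_normal \<partial>std_normal) + (\<integral>\<^sup>+a. \<integral>\<^sup>+b. h b a \<partial>std_normal \<partial>std_normal)"
      by (intro nn_integral_add) auto
    finally show ?thesis using sym[OF that] by (simp add: mult_2)
  qed
  have EG: "?E a b + ?E b a \<le> ?G a b + ?G b a" for a b
  proof -
    have cosh_le: "exp x + exp (- x) \<le> exp y + exp (- y)" if "\<bar>x\<bar> \<le> \<bar>y\<bar>" for x y :: real
    proof -
      have "cosh \<bar>x\<bar> \<le> cosh \<bar>y\<bar>" using that by (subst cosh_real_nonneg_le_iff) auto
      then show ?thesis by (simp only: cosh_real_abs) (simp add: cosh_def)
    qed
    have "\<bar>l * (f a - f b)\<bar> \<le> \<bar>l * c * (a - b)\<bar>"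
      using mult_left_mono[OF order_trans[OF lip[of a b], of "\<bar>c\<bar> * \<bar>a - b\<bar>"], of "\<bar>l\<bar>"]
      by (auto simp: abs_mult mult_right_mono)
    from cosh_le[OF this] show ?thesis
      by (simp add: ennreal_plus[symmetric] algebra_simps del: ennreal_plus)
  qed
  have "(\<integral>\<^sup>+a. ennreal (exp (l * (f a - (\<integral>b. f b \<partial>std_normal)))) \<partial>std_normal)
      \<le> (\<integral>\<^sup>+a. \<integral>\<^sup>+b. ?E a b \<partial>std_normal \<partial>std_normal)"
    by (intro nn_integral_mono le)
  also have "\<dots> \<le> (\<integral>\<^sup>+a. \<integral>\<^sup>+b. ?G a b \<partial>std_normal \<partial>std_normal)"
  proof -
    have "2 * (\<integral>\<^sup>+a. \<integral>\<^sup>+b. ?E a b \<partial>std_normal \<partial>std_normal) \<le> 2 * (\<integral>\<^sup>+a. \<integral>\<^sup>+b. ?G a b \<partial>std_normal \<partial>std_normal)"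
      by (subst (1 2) add[symmetric]) (auto intro!: nn_integral_mono EG)
    then show ?thesis by (simp add: ennreal_mult_le_mult_iff)
  qed
  \<comment> \<open>The exponential factorises over the two copies. Each contributes
    \<open>exp ((l * c)\<^sup>2 / 2)\<close>, which is why the final exponent carries no factor one
    half.\<close>
  also have "\<dots> = (\<integral>\<^sup>+a. ennreal (exp (l * c * a)) * (\<integral>\<^sup>+b. ennreal (exp ((- (l * c)) * b)) \<partial>std_normal) \<partial>std_normal)"
    by (intro nn_integral_cong, subst nn_integral_cmult[symmetric])
       (auto simp: ennreal_mult'[symmetric] exp_add[symmetric] algebra_simps)
  also have "\<dots> = ennreal (exp ((l * c)\<^sup>2 / 2)) * ennreal (exp ((- (l * c))\<^sup>2 / 2))"
    by (subst nn_integral_multc) (simp_all only: nn_integral_exp_std_normal, auto)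
  also have "\<dots> = ennreal (exp (l\<^sup>2 * c\<^sup>2))"
    by (simp add: ennreal_mult'[symmetric] exp_add[symmetric] power_mult_distrib)
  finally show ?thesis .
qed

text \<open>Only extensional points are constrained, because they make up the space of the product
  measure; updating a coordinate in \<open>I\<close> keeps a point extensional.\<close>

definition coord_lipschitz :: "'i set \<Rightarrow> real \<Rightarrow> (('i \<Rightarrow> real) \<Rightarrow> real) \<Rightarrow> bool" where
  "coord_lipschitz I c F \<longleftrightarrow>
     (\<forall>s\<in>extensional I. \<forall>i\<in>I. \<forall>a b. \<bar>F (s(i := a)) - F (s(i := b))\<bar> \<le> c * \<bar>a - b\<bar>)"

text \<open>The point \<open>s\<close> is turned into \<open>t\<close> one coordinate at a time,
  each change costing at most the Lipschitz bound in that coordinate. The induction generalises over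
  \<open>s\<close> and keeps \<open>t\<close> fixed.\<close>

lemma coord_lipschitz_bound:
  assumes "finite J" "J \<subseteq> I" "coord_lipschitz I c F" "s \<in> extensional I" "t \<in> extensional I"
    "\<And>i. i \<notin> J \<Longrightarrow> s i = t i"
  shows "\<bar>F s - F t\<bar> \<le> c * (\<Sum>i\<in>J. \<bar>s i - t i\<bar>)"
  using assms(1,2,4,6)
proof (induction J arbitrary: s rule: finite_induct)
  case empty
  then have "s = t" by auto
  then show ?case by simp
next
  case (insert j J)
  let ?s = "s(j := t j)"
  have "\<bar>F ?s - F t\<bar> \<le> c * (\<Sum>i\<in>J. \<bar>?s i - t i\<bar>)"
    using insert.prems by (intro insert.IH) (auto simp: extensional_def)
  also have "(\<Sum>i\<in>J. \<bar>?s i - t i\<bar>) = (\<Sum>i\<in>J. \<bar>s i - t i\<bar>)"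
    using insert.hyps by (intro sum.cong) auto
  finally have 1: "\<bar>F ?s - F t\<bar> \<le> c * (\<Sum>i\<in>J. \<bar>s i - t i\<bar>)" .
  have "\<bar>F (s(j := s j)) - F ?s\<bar> \<le> c * \<bar>s j - t j\<bar>"
    using assms(3) insert.prems unfolding coord_lipschitz_def by blast
  with 1 show ?case using insert.hyps by (simp add: algebra_simps)
qed

text \<open>Comparison with the zero point shows that \<open>F\<close> grows at most linearly in the
  absolute coordinates, each of which has a finite first moment.\<close>

lemma coord_lipschitz_integrable:
  assumes "finite I" and [measurable]: "F \<in> borel_measurable (PiM I (\<lambda>_. std_normal))"
    and lip: "coord_lipschitz I c F"
  shows "integrable (PiM I (\<lambda>_. std_normal)) F"
proof (rule Bochner_Integration.integrable_bound)
  let ?M = "PiM I (\<lambda>_. std_normal)" and ?t = "\<lambda>i\<in>I. 0 :: real"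
  have comp: "integrable ?M (\<lambda>s. \<bar>s i\<bar>)" if "i \<in> I" for i
  proof -
    have "integrable (distr ?M std_normal (\<lambda>s. s i)) (\<lambda>x. \<bar>x\<bar>)"
      using integrable_abs_std_normal by (subst distr_PiM_component) (auto intro: std_normal.prob_space_axioms that)
    then show ?thesis using that by (subst (asm) integrable_distr_eq) auto
  qed
  show "integrable ?M (\<lambda>s. \<bar>F ?t\<bar> + c * (\<Sum>i\<in>I. \<bar>s i\<bar>))"
    using comp prob_space.finite_measure[OF prob_space_std_normal_PiM]
    by (intro Bochner_Integration.integrable_add integrable_mult_right
        Bochner_Integration.integrable_sum finite_measure.integrable_const) auto
  show "AE s in ?M. norm (F s) \<le> norm (\<bar>F ?t\<bar> + c * (\<Sum>i\<in>I. \<bar>s i\<bar>))"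
  proof (rule AE_I2)
    fix s assume "s \<in> space ?M"
    then have s: "s \<in> extensional I" by (auto simp: space_PiM PiE_def)
    have "\<bar>F s - F ?t\<bar> \<le> c * (\<Sum>i\<in>I. \<bar>s i - ?t i\<bar>)"
      using s by (intro coord_lipschitz_bound[OF assms(1) order_refl lip]) (auto simp: extensional_def)
    then show "norm (F s) \<le> norm (\<bar>F ?t\<bar> + c * (\<Sum>i\<in>I. \<bar>s i\<bar>))" by simp
  qed
qed simp

text \<open>Induction on the index set: averaging out the coordinate \<open>j\<close> leaves a
  function \<open>G\<close> that is Lipschitz in the other coordinates with the same constant and
  has the same mean. Each averaged coordinate costs one factor
  \<open>exp (l\<^sup>2 * c\<^sup>2)\<close>.\<close>

lemma coord_lipschitz_mgf:
  fixes F :: "('i \<Rightarrow> real) \<Rightarrow> real"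
  assumes "finite I" and "F \<in> borel_measurable (PiM I (\<lambda>_. std_normal))" and "coord_lipschitz I c F"
  shows "(\<integral>\<^sup>+s. ennreal (exp (l * (F s - (\<integral>t. F t \<partial>PiM I (\<lambda>_. std_normal))))) \<partial>PiM I (\<lambda>_. std_normal))
     \<le> ennreal (exp (l\<^sup>2 * c\<^sup>2 * card I))"
  using assms
proof (induction I arbitrary: F rule: finite_induct)
  case empty
  have "(\<integral>t. F t \<partial>PiM {} (\<lambda>_. std_normal)) = F (\<lambda>_. undefined)"
    by (simp add: PiM_empty lebesgue_integral_count_space_finite)
  then show ?case by (simp add: PiM_empty nn_integral_count_space_finite)
next
  case (insert j J)
  let ?M = "PiM J (\<lambda>_. std_normal)" and ?M' = "PiM (insert j J) (\<lambda>_. std_normal)"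
  note [measurable] = insert.prems(1)
  interpret M: prob_space ?M by (rule prob_space_std_normal_PiM)
  define G where "G s = (\<integral>a. F (s(j := a)) \<partial>std_normal)" for s
  have ext: "s(j := a) \<in> extensional (insert j J)" if "s \<in> extensional J" for s and a :: real
    using that by (auto simp: extensional_def)
  have slip: "\<bar>F (s(j := a)) - F (s(j := b))\<bar> \<le> c * \<bar>a - b\<bar>" if "s \<in> extensional J" for s a b
  proof -
    have "s(j := 0) \<in> extensional (insert j J)" by (rule ext[OF that])
    with insert.prems(2) have "\<bar>F (s(j := 0, j := a)) - F (s(j := 0, j := b))\<bar> \<le> c * \<bar>a - b\<bar>"
      unfolding coord_lipschitz_def by blast
    then show ?thesis by simp
  qed
  have smeas: "(\<lambda>a. F (s(j := a))) \<in> borel_measurable borel" if "s \<in> extensional J" for s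
  proof -
    have "s \<in> space ?M" using that by (auto simp: space_PiM PiE_def)
    from measurable_component_update[OF this insert.hyps(2)]
    have "(\<lambda>a. F (s(j := a))) \<in> borel_measurable std_normal"
      by (rule measurable_compose) (rule insert.prems(1))
    then show ?thesis by simp
  qed
  have sint: "integrable std_normal (\<lambda>a. F (s(j := a)))" if "s \<in> extensional J" for s
    by (rule lipschitz_integrable_std_normal[OF smeas slip]) (use that in auto)
  have Fj[measurable]: "(\<lambda>(s, a). F (s(j := a))) \<in> borel_measurable (?M \<Otimes>\<^sub>M std_normal)"
    using measurable_comp[OF measurable_add_dim insert.prems(1)] by (simp add: comp_def case_prod_beta)
  have Gm[measurable]: "G \<in> borel_measurable ?M"
    unfolding G_def by (rule std_normal.borel_measurable_lebesgue_integral) (rule Fj)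
  have Glip: "coord_lipschitz J c G"
    unfolding coord_lipschitz_def
  proof (intro ballI allI)
    fix s :: "'i \<Rightarrow> real" and i and a b :: real assume s: "s \<in> extensional J" and i: "i \<in> J"
    have sa: "s(i := a) \<in> extensional J" for a using s i by (auto simp: extensional_def)
    have "\<bar>G (s(i := a)) - G (s(i := b))\<bar> = \<bar>\<integral>y. F (s(i := a, j := y)) - F (s(i := b, j := y)) \<partial>std_normal\<bar>"
      unfolding G_def using sint[OF sa] by (subst Bochner_Integration.integral_diff) auto
    also have "\<dots> \<le> (\<integral>y. \<bar>F (s(i := a, j := y)) - F (s(i := b, j := y))\<bar> \<partial>std_normal)"
      by (rule integral_abs_bound)
    also have "\<dots> \<le> (\<integral>y. c * \<bar>a - b\<bar> \<partial>std_normal)"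
    proof (rule integral_mono)
      fix y
      have "i \<noteq> j" using i insert.hyps by auto
      moreover have "\<bar>F (s(j := y, i := a)) - F (s(j := y, i := b))\<bar> \<le> c * \<bar>a - b\<bar>"
        using insert.prems(2) ext[OF s] i unfolding coord_lipschitz_def by blast
      ultimately show "\<bar>F (s(i := a, j := y)) - F (s(i := b, j := y))\<bar> \<le> c * \<bar>a - b\<bar>"
        by (simp add: fun_upd_twist)
    qed (use sint[OF sa] in auto)
    also have "\<dots> = c * \<bar>a - b\<bar>" by (simp add: std_normal.prob_space[simplified])
    finally show "\<bar>G (s(i := a)) - G (s(i := b))\<bar> \<le> c * \<bar>a - b\<bar>" .
  qed
  have Fint: "integrable ?M' F"
    by (rule coord_lipschitz_integrable) (use insert in auto)
  have EF: "(\<integral>t. F t \<partial>?M') = (\<integral>t. G t \<partial>?M)"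
    unfolding G_def by (rule std_normal_PiM.product_integral_insert[OF insert.hyps Fint])
  have "(\<integral>\<^sup>+s. ennreal (exp (l * (F s - (\<integral>t. F t \<partial>?M')))) \<partial>?M') =
     (\<integral>\<^sup>+s. \<integral>\<^sup>+a. ennreal (exp (l * (F (s(j := a)) - (\<integral>t. G t \<partial>?M)))) \<partial>std_normal \<partial>?M)"
    unfolding EF by (rule std_normal_PiM.product_nn_integral_insert[OF insert.hyps]) simp
  also have "\<dots> \<le> (\<integral>\<^sup>+s. ennreal (exp (l * (G s - (\<integral>t. G t \<partial>?M)))) * ennreal (exp (l\<^sup>2 * c\<^sup>2)) \<partial>?M)"
  proof (rule nn_integral_mono)
    fix s assume "s \<in> space ?M"
    then have s: "s \<in> extensional J" by (auto simp: space_PiM PiE_def)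
    note [measurable] = smeas[OF s]
    \<comment> \<open>With \<open>s\<close> fixed, the deviation of \<open>F\<close> splits into the
      deviation of \<open>G s\<close> and the fluctuation in coordinate \<open>j\<close> about its
      own mean \<open>G s\<close>; the latter is the one-variable case.\<close>
    have "(\<integral>\<^sup>+a. ennreal (exp (l * (F (s(j := a)) - (\<integral>t. G t \<partial>?M)))) \<partial>std_normal) =
      (\<integral>\<^sup>+a. ennreal (exp (l * (G s - (\<integral>t. G t \<partial>?M)))) * ennreal (exp (l * (F (s(j := a)) - G s))) \<partial>std_normal)"
      by (intro nn_integral_cong) (auto simp: ennreal_mult'[symmetric] exp_add[symmetric] algebra_simps)
    also have "\<dots> = ennreal (exp (l * (G s - (\<integral>t. G t \<partial>?M)))) * (\<integral>\<^sup>+a. ennreal (exp (l * (F (s(j := a)) - G s))) \<partial>std_normal)"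
      by (intro nn_integral_cmult) simp
    also have "\<dots> \<le> ennreal (exp (l * (G s - (\<integral>t. G t \<partial>?M)))) * ennreal (exp (l\<^sup>2 * c\<^sup>2))"
      unfolding G_def[of s] by (intro mult_left_mono lipschitz_mgf_std_normal smeas slip s) auto
    finally show "(\<integral>\<^sup>+a. ennreal (exp (l * (F (s(j := a)) - (\<integral>t. G t \<partial>?M)))) \<partial>std_normal) \<le> \<dots>" .
  qed
  also have "\<dots> = (\<integral>\<^sup>+s. ennreal (exp (l * (G s - (\<integral>t. G t \<partial>?M)))) \<partial>?M) * ennreal (exp (l\<^sup>2 * c\<^sup>2))"
    by (rule nn_integral_multc) simp
  also have "\<dots> \<le> ennreal (exp (l\<^sup>2 * c\<^sup>2 * card J)) * ennreal (exp (l\<^sup>2 * c\<^sup>2))"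
    by (intro mult_right_mono insert.IH Gm Glip) auto
  also have "\<dots> = ennreal (exp (l\<^sup>2 * c\<^sup>2 * card (insert j J)))"
    using insert.hyps by (simp add: ennreal_mult'[symmetric] exp_add[symmetric] algebra_simps)
  finally show ?case .
qed

lemma coord_lipschitz_concentration:
  fixes F :: "('i \<Rightarrow> real) \<Rightarrow> real" and I :: "'i set" and c t :: real
  defines "M \<equiv> PiM I (\<lambda>_. std_normal)"
  assumes "finite I" and Fm: "F \<in> borel_measurable M" and lip: "coord_lipschitz I c F"
    and V: "c\<^sup>2 * card I \<le> V" "V > 0" and "t > 0"
  shows "measure M {s \<in> space M. \<bar>F s - (\<integral>s. F s \<partial>M)\<bar> \<ge> t} \<le> 2 * exp (- t\<^sup>2 / (4 * V))"
proof -
  note [measurable] = Fm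
  interpret prob_space M unfolding M_def by (rule prob_space_std_normal_PiM)
  have tail: "measure M {s \<in> space M. H s - (\<integral>s. H s \<partial>M) \<ge> t} \<le> exp (- t\<^sup>2 / (4 * V))"
    if [measurable]: "H \<in> borel_measurable M" and H: "coord_lipschitz I c H" for H
  proof -
    \<comment> \<open>This value minimises the Chernoff exponent
      \<open>- l * t + l\<^sup>2 * V\<close>.\<close>
    define l where "l = t / (2 * V)"
    have l: "l > 0" using V \<open>t > 0\<close> by (simp add: l_def)
    have "emeasure M {s \<in> space M. H s - (\<integral>s. H s \<partial>M) \<ge> t} \<le>
      ennreal (exp (- l * t)) * (\<integral>\<^sup>+s. ennreal (exp (l * (H s - (\<integral>s. H s \<partial>M)))) * indicator (space M) s \<partial>M)"
      by (rule Chernoff_ineq_nn_integral_ge[OF l]) auto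
    also have "(\<integral>\<^sup>+s. ennreal (exp (l * (H s - (\<integral>s. H s \<partial>M)))) * indicator (space M) s \<partial>M) =
      (\<integral>\<^sup>+s. ennreal (exp (l * (H s - (\<integral>s. H s \<partial>M)))) \<partial>M)"
      by (intro nn_integral_cong) auto
    also have "ennreal (exp (- l * t)) * \<dots> \<le> ennreal (exp (- l * t)) * ennreal (exp (l\<^sup>2 * c\<^sup>2 * card I))"
      unfolding M_def using that by (intro mult_left_mono coord_lipschitz_mgf \<open>finite I\<close>) (auto simp: M_def)
    also have "\<dots> = ennreal (exp (- l * t + l\<^sup>2 * (c\<^sup>2 * card I)))"
      by (simp add: ennreal_mult'[symmetric] exp_add[symmetric] algebra_simps)
    also have "\<dots> \<le> ennreal (exp (- l * t + l\<^sup>2 * V))"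
      using mult_left_mono[OF V(1), of "l\<^sup>2"] by (intro ennreal_leI) simp
    also have "- l * t + l\<^sup>2 * V = - t\<^sup>2 / (4 * V)"
      using V by (simp add: l_def field_simps power2_eq_square)
    finally show ?thesis by (simp add: emeasure_eq_measure)
  qed
  \<comment> \<open>The lower tail of \<open>F\<close> is the upper tail of \<open>- F\<close>,
    which satisfies the same Lipschitz condition.\<close>
  have sub: "{s \<in> space M. \<bar>F s - (\<integral>s. F s \<partial>M)\<bar> \<ge> t} \<subseteq>
     {s \<in> space M. F s - (\<integral>s. F s \<partial>M) \<ge> t} \<union> {s \<in> space M. - F s - (\<integral>s. - F s \<partial>M) \<ge> t}"
    by auto
  have "measure M {s \<in> space M. \<bar>F s - (\<integral>s. F s \<partial>M)\<bar> \<ge> t} \<le>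
    measure M {s \<in> space M. F s - (\<integral>s. F s \<partial>M) \<ge> t} + measure M {s \<in> space M. - F s - (\<integral>s. - F s \<partial>M) \<ge> t}"
    by (rule order_trans[OF finite_measure_mono[OF sub] measure_Un_le]) measurable
  moreover have "coord_lipschitz I c (\<lambda>s. - F s)"
    using lip by (simp add: coord_lipschitz_def abs_minus_commute)
  ultimately show ?thesis using tail[OF Fm lip] tail[of "\<lambda>s. - F s"] by simp
qed

section \<open>Mutual information of Gaussian location mixtures\<close>

definition gauss_density :: "'i set \<Rightarrow> real \<Rightarrow> ('i \<Rightarrow> real) \<Rightarrow> ('i \<Rightarrow> real) \<Rightarrow> real" where
  "gauss_density I \<sigma> m y = (\<Prod>i\<in>I. normal_density (m i) \<sigma> (y i))"

text \<open>The product form gives direct access to marginals and translations. The form with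
  density \<open>gauss_density\<close>, in which different means share one reference measure, is
  recovered in \<open>gauss_measure_eq_density\<close>.\<close>

definition gauss_measure :: "'i set \<Rightarrow> real \<Rightarrow> ('i \<Rightarrow> real) \<Rightarrow> ('i \<Rightarrow> real) measure" where
  "gauss_measure I \<sigma> m = PiM I (\<lambda>i. density lborel (normal_density (m i) \<sigma>))"

lemma sets_gauss_measure[measurable_cong]: "sets (gauss_measure I \<sigma> m) = sets (PiM I (\<lambda>_. lborel))"
  unfolding gauss_measure_def by (intro sets_PiM_cong) auto

lemma measurable_gauss_density[measurable]: "gauss_density I \<sigma> m \<in> borel_measurable (PiM I (\<lambda>_. lborel))"
  unfolding gauss_density_def by measurable

lemma prob_space_gauss_measure: "\<sigma> > 0 \<Longrightarrow> prob_space (gauss_measure I \<sigma> m)"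
  unfolding gauss_measure_def by (intro prob_space_PiM prob_space_normal_density)

lemma product_sigma_finite_normal:
  "\<sigma> > 0 \<Longrightarrow> product_sigma_finite (\<lambda>i. density lborel (normal_density (m i) \<sigma>))"
  by (intro product_sigma_finite.intro prob_space_imp_sigma_finite prob_space_normal_density)

text \<open>A product measure is determined by its values on boxes. There the indicator is a product
  too, so Fubini reduces the claim to one dimension.\<close>

lemma gauss_measure_eq_density:
  assumes "finite I" "\<sigma> > 0"
  shows "gauss_measure I \<sigma> m = density (PiM I (\<lambda>_. lborel)) (gauss_density I \<sigma> m)"
proof -
  interpret N: product_sigma_finite "\<lambda>i. density lborel (normal_density (m i) \<sigma>)"
    by (rule product_sigma_finite_normal[OF \<open>\<sigma> > 0\<close>])
  interpret L: product_sigma_finite "\<lambda>_. lborel :: real measure" by unfold_locales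
  show ?thesis
    unfolding gauss_measure_def
  proof (rule N.PiM_eqI[OF \<open>finite I\<close>, symmetric])
    show "sets (density (PiM I (\<lambda>_. lborel)) (gauss_density I \<sigma> m)) =
        sets (PiM I (\<lambda>i. density lborel (normal_density (m i) \<sigma>)))"
      unfolding sets_density sets_distr by (intro sets_PiM_cong) auto
    fix A assume A: "\<And>i. i \<in> I \<Longrightarrow> A i \<in> sets (density lborel (normal_density (m i) \<sigma>))"
    then have [measurable]: "i \<in> I \<Longrightarrow> A i \<in> sets borel" for i by simp
    have PA[measurable]: "Pi\<^sub>E I A \<in> sets (PiM I (\<lambda>_. lborel))"
      using A \<open>finite I\<close> by (intro sets_PiM_I_finite) auto
    have "emeasure (density (PiM I (\<lambda>_. lborel)) (gauss_density I \<sigma> m)) (Pi\<^sub>E I A) =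
      (\<integral>\<^sup>+y. ennreal (gauss_density I \<sigma> m y) * indicator (Pi\<^sub>E I A) y \<partial>PiM I (\<lambda>_. lborel))"
      by (intro emeasure_density) auto
    also have "\<dots> = (\<integral>\<^sup>+y. (\<Prod>i\<in>I. ennreal (normal_density (m i) \<sigma> (y i)) * indicator (A i) (y i)) \<partial>PiM I (\<lambda>_. lborel))"
    proof (rule nn_integral_cong)
      fix y assume "y \<in> space (PiM I (\<lambda>_. lborel :: real measure))"
      then have y: "y \<in> extensional I" by (auto simp: space_PiM PiE_def)
      have "indicator (Pi\<^sub>E I A) y = (\<Prod>i\<in>I. indicator (A i) (y i) :: ennreal)"
      proof (cases "\<forall>i\<in>I. y i \<in> A i")
        case True
        then have "y \<in> Pi\<^sub>E I A" using y by (auto simp: PiE_def)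
        then show ?thesis using True by simp
      next
        case False
        then obtain i where i: "i \<in> I" "y i \<notin> A i" by auto
        then have "y \<notin> Pi\<^sub>E I A" by auto
        moreover have "(\<Prod>i\<in>I. indicator (A i) (y i) :: ennreal) = 0"
          using i \<open>finite I\<close> by (intro prod_zero bexI[of _ i]) auto
        ultimately show ?thesis by simp
      qed
      then show "ennreal (gauss_density I \<sigma> m y) * indicator (Pi\<^sub>E I A) y =
          (\<Prod>i\<in>I. ennreal (normal_density (m i) \<sigma> (y i)) * indicator (A i) (y i))"
        by (simp add: gauss_density_def prod.distrib prod_ennreal)
    qed
    also have "\<dots> = (\<Prod>i\<in>I. \<integral>\<^sup>+t. ennreal (normal_density (m i) \<sigma> t) * indicator (A i) t \<partial>lborel)"
      using \<open>finite I\<close> by (intro L.product_nn_integral_prod) auto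
    also have "\<dots> = (\<Prod>i\<in>I. emeasure (density lborel (normal_density (m i) \<sigma>)) (A i))"
      by (intro prod.cong refl emeasure_density[symmetric]) auto
    finally show "emeasure (density (PiM I (\<lambda>_. lborel)) (gauss_density I \<sigma> m)) (Pi\<^sub>E I A) = \<dots>" .
  qed
qed

lemma measurable_shift_coord[measurable]:
  assumes "i \<in> I"
  shows "(\<lambda>y. y(i := y i + u)) \<in> measurable (PiM I (\<lambda>_. lborel :: real measure)) (PiM I (\<lambda>_. lborel))"
  by (rule measurable_fun_upd[where J = I]) (use assms in auto)

text \<open>Again a comparison on boxes: the preimage of a box is the box with side \<open>i\<close>
  translated, and Lebesgue measure is translation invariant.\<close>

lemma distr_shift_gauss_measure:
  assumes "finite I" "\<sigma> > 0" "i \<in> I"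
  shows "distr (gauss_measure I \<sigma> m) (PiM I (\<lambda>_. lborel)) (\<lambda>y. y(i := y i + u)) =
    gauss_measure I \<sigma> (m(i := m i + u))"
proof -
  let ?m = "m(i := m i + u)"
  interpret N: product_sigma_finite "\<lambda>j. density lborel (normal_density (m j) \<sigma>)"
    by (rule product_sigma_finite_normal[OF \<open>\<sigma> > 0\<close>])
  interpret N': product_sigma_finite "\<lambda>j. density lborel (normal_density (?m j) \<sigma>)"
    by (rule product_sigma_finite_normal[OF \<open>\<sigma> > 0\<close>])
  show ?thesis
    unfolding gauss_measure_def[of I \<sigma> ?m]
  proof (rule N'.PiM_eqI[OF \<open>finite I\<close>])
    show "sets (distr (gauss_measure I \<sigma> m) (PiM I (\<lambda>_. lborel)) (\<lambda>y. y(i := y i + u))) =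
        sets (PiM I (\<lambda>i. density lborel (normal_density (?m i) \<sigma>)))"
      unfolding sets_density sets_distr by (intro sets_PiM_cong) auto
    fix A assume A: "\<And>j. j \<in> I \<Longrightarrow> A j \<in> sets (density lborel (normal_density (?m j) \<sigma>))"
    then have Am: "j \<in> I \<Longrightarrow> A j \<in> sets borel" for j by simp
    define B where "B = A(i := (\<lambda>t. t + u) -` A i)"
    have Bi: "(\<lambda>t. t + u) -` A i \<in> sets borel"
      using measurable_sets[OF _ Am[OF \<open>i \<in> I\<close>], of "\<lambda>t. t + u" borel] by simp
    have Bm: "j \<in> I \<Longrightarrow> B j \<in> sets borel" for j
      using Am Bi by (auto simp: B_def)
    have PA: "Pi\<^sub>E I A \<in> sets (PiM I (\<lambda>_. lborel))"
      using Am \<open>finite I\<close> by (intro sets_PiM_I_finite) auto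
    have "emeasure (distr (gauss_measure I \<sigma> m) (PiM I (\<lambda>_. lborel)) (\<lambda>y. y(i := y i + u))) (Pi\<^sub>E I A) =
      emeasure (gauss_measure I \<sigma> m) ((\<lambda>y. y(i := y i + u)) -` Pi\<^sub>E I A \<inter> space (gauss_measure I \<sigma> m))"
      by (rule emeasure_distr[OF _ PA]) (use assms in measurable)
    also have "(\<lambda>y. y(i := y i + u)) -` Pi\<^sub>E I A \<inter> space (gauss_measure I \<sigma> m) = Pi\<^sub>E I B"
      using \<open>i \<in> I\<close> unfolding gauss_measure_def B_def
      by (auto simp: space_PiM PiE_iff extensional_def split: if_splits)
    also have "emeasure (gauss_measure I \<sigma> m) (Pi\<^sub>E I B) =
        (\<Prod>j\<in>I. emeasure (density lborel (normal_density (m j) \<sigma>)) (B j))"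
      unfolding gauss_measure_def using Bm by (intro N.emeasure_PiM \<open>finite I\<close>) auto
    also have "\<dots> = (\<Prod>j\<in>I. emeasure (density lborel (normal_density (?m j) \<sigma>)) (A j))"
    proof (rule prod.cong[OF refl])
      fix j assume j: "j \<in> I"
      show "emeasure (density lborel (normal_density (m j) \<sigma>)) (B j) =
          emeasure (density lborel (normal_density (?m j) \<sigma>)) (A j)"
      proof (cases "j = i")
        case True
        have "emeasure (density lborel (normal_density (m i + u) \<sigma>)) (A i) =
          (\<integral>\<^sup>+t. ennreal (normal_density (m i + u) \<sigma> t) * indicator (A i) t \<partial>lborel)"
          using Am j True by (intro emeasure_density) auto
        also have "\<dots> = (\<integral>\<^sup>+t. ennreal (normal_density (m i + u) \<sigma> (u + 1 * t)) * indicator (A i) (u + 1 * t) \<partial>lborel)"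
          using Am j True by (subst nn_integral_real_affine[where c = 1 and t = u]) auto
        also have "\<dots> = (\<integral>\<^sup>+t. ennreal (normal_density (m i) \<sigma> t) * indicator (B i) t \<partial>lborel)"
          by (intro nn_integral_cong) (auto simp: B_def normal_density_def indicator_def add.commute)
        also have "\<dots> = emeasure (density lborel (normal_density (m i) \<sigma>)) (B i)"
          using Bm j True by (intro emeasure_density[symmetric]) auto
        finally show ?thesis using True by simp
      qed (simp add: B_def)
    qed
    finally show "emeasure (distr (gauss_measure I \<sigma> m) (PiM I (\<lambda>_. lborel)) (\<lambda>y. y(i := y i + u))) (Pi\<^sub>E I A) = \<dots>" .
  qed
qed

lemma gauss_density_pos: "\<sigma> > 0 \<Longrightarrow> gauss_density I \<sigma> m y > 0"
  unfolding gauss_density_def by (intro prod_pos) (auto simp: normal_density_pos)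

lemma gauss_density_shift_both:
  "gauss_density I \<sigma> (m(i := m i + u)) (y(i := y i + u)) = gauss_density I \<sigma> m y"
  unfolding gauss_density_def by (intro prod.cong) (auto simp: normal_density_def)

lemma gauss_density_shift:
  assumes "finite I" "i \<in> I" "\<sigma> > 0"
  shows "gauss_density I \<sigma> m (y(i := y i + u)) =
    gauss_density I \<sigma> m y * exp (- (2 * u * (y i - m i) + u\<^sup>2) / (2 * \<sigma>\<^sup>2))"
proof -
  have "normal_density (m i) \<sigma> (y i + u) =
      normal_density (m i) \<sigma> (y i) * exp (- (2 * u * (y i - m i) + u\<^sup>2) / (2 * \<sigma>\<^sup>2))"
    using assms by (simp add: normal_density_def exp_add[symmetric] add_divide_distrib[symmetric]
        diff_divide_distrib[symmetric] power2_eq_square algebra_simps)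
  moreover have "(\<Prod>j\<in>I - {i}. normal_density (m j) \<sigma> ((y(i := y i + u)) j)) =
      (\<Prod>j\<in>I - {i}. normal_density (m j) \<sigma> (y j))"
    by (intro prod.cong) auto
  ultimately show ?thesis
    using assms unfolding gauss_density_def by (subst (1 2) prod.remove[of I i]) auto
qed

lemma ln_gauss_density:
  assumes "finite I" "\<sigma> > 0"
  shows "ln (gauss_density I \<sigma> m y) =
    card I * ln (normal_density 0 \<sigma> 0) - (\<Sum>i\<in>I. (y i - m i)\<^sup>2) / (2 * \<sigma>\<^sup>2)"
proof -
  have "ln (normal_density a \<sigma> t) = ln (normal_density 0 \<sigma> 0) - (t - a)\<^sup>2 / (2 * \<sigma>\<^sup>2)" for a t
    using \<open>\<sigma> > 0\<close> by (simp add: normal_density_def ln_mult ln_div)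
  then have "(\<Sum>i\<in>I. ln (normal_density (m i) \<sigma> (y i))) =
      (\<Sum>i\<in>I. ln (normal_density 0 \<sigma> 0) - (y i - m i)\<^sup>2 / (2 * \<sigma>\<^sup>2))"
    by (intro sum.cong refl)
  moreover have "normal_density a \<sigma> t \<noteq> 0" for a t
    using normal_density_pos[OF \<open>\<sigma> > 0\<close>] by (metis less_irrefl)
  ultimately show ?thesis
    using assms unfolding gauss_density_def
    by (subst ln_prod) (auto simp: sum_subtractf sum_divide_distrib)
qed

lemma gauss_measure_component:
  assumes "\<sigma> > 0" "i \<in> I"
  shows "distr (gauss_measure I \<sigma> m) lborel (\<lambda>y. y i) = density lborel (normal_density (m i) \<sigma>)"
proof -
  have "distr (gauss_measure I \<sigma> m) (density lborel (normal_density (m i) \<sigma>)) (\<lambda>y. y i) =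
      density lborel (normal_density (m i) \<sigma>)"
    unfolding gauss_measure_def
    by (rule distr_PiM_component) (use assms in \<open>auto intro: prob_space_normal_density\<close>)
  moreover have "distr (gauss_measure I \<sigma> m) (density lborel (normal_density (m i) \<sigma>)) (\<lambda>y. y i) =
      distr (gauss_measure I \<sigma> m) lborel (\<lambda>y. y i)"
    by (intro distr_cong) auto
  ultimately show ?thesis by simp
qed

lemma gauss_measure_integrable_component:
  assumes "\<sigma> > 0" "i \<in> I" and [measurable]: "f \<in> borel_measurable borel"
    and f: "integrable lborel (\<lambda>t. normal_density (m i) \<sigma> t * f t)"
  shows "integrable (gauss_measure I \<sigma> m) (\<lambda>y. f (y i) :: real)"
    and "(\<integral>y. f (y i) \<partial>gauss_measure I \<sigma> m) = (\<integral>t. normal_density (m i) \<sigma> t * f t \<partial>lborel)"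
proof -
  have comp: "(\<lambda>y. y i) \<in> measurable (gauss_measure I \<sigma> m) lborel"
    using measurable_component_singleton[OF \<open>i \<in> I\<close>, of "\<lambda>_. lborel"]
    by (subst measurable_cong_sets[OF sets_gauss_measure refl])
  have f': "f \<in> borel_measurable lborel" by simp
  have "integrable (distr (gauss_measure I \<sigma> m) lborel (\<lambda>y. y i)) f"
    unfolding gauss_measure_component[OF assms(1,2)] using f by (subst integrable_density) auto
  then show "integrable (gauss_measure I \<sigma> m) (\<lambda>y. f (y i))"
    by (simp only: integrable_distr_eq[OF comp f'])
  have "(\<integral>y. f (y i) \<partial>gauss_measure I \<sigma> m) = (\<integral>t. f t \<partial>distr (gauss_measure I \<sigma> m) lborel (\<lambda>y. y i))"
    by (simp only: integral_distr[OF comp f'])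
  also have "\<dots> = (\<integral>t. normal_density (m i) \<sigma> t * f t \<partial>lborel)"
    unfolding gauss_measure_component[OF assms(1,2)] by (subst integral_density) auto
  finally show "(\<integral>y. f (y i) \<partial>gauss_measure I \<sigma> m) = (\<integral>t. normal_density (m i) \<sigma> t * f t \<partial>lborel)" .
qed

lemma gauss_measure_integrable_square:
  assumes "\<sigma> > 0" "i \<in> I"
  shows "integrable (gauss_measure I \<sigma> m) (\<lambda>y. (y i - a)\<^sup>2)"
proof (rule gauss_measure_integrable_component(1)[where f = "\<lambda>t. (t - a)\<^sup>2", OF assms])
  \<comment> \<open>The square is expanded about the mean \<open>m i\<close>, leaving central
    moments of orders 2, 1 and 0.\<close>
  have "normal_density (m i) \<sigma> t * (t - a)\<^sup>2 =
      normal_density (m i) \<sigma> t * (t - m i) ^ 2 + (2 * (m i - a)) * (normal_density (m i) \<sigma> t * (t - m i) ^ 1) +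
      (m i - a)\<^sup>2 * (normal_density (m i) \<sigma> t * (t - m i) ^ 0)" for t
    by (simp add: power2_eq_square algebra_simps)
  moreover have "integrable lborel (\<lambda>t. normal_density (m i) \<sigma> t * (t - m i) ^ 2 +
      (2 * (m i - a)) * (normal_density (m i) \<sigma> t * (t - m i) ^ 1) +
      (m i - a)\<^sup>2 * (normal_density (m i) \<sigma> t * (t - m i) ^ 0))"
    by (intro Bochner_Integration.integrable_add integrable_mult_right integrable_normal_moment \<open>\<sigma> > 0\<close>)
  ultimately show "integrable lborel (\<lambda>t. normal_density (m i) \<sigma> t * (t - a)\<^sup>2)" by simp
qed simp

lemma gauss_measure_abs_moment:
  assumes "\<sigma> > 0" "i \<in> I"
  shows "integrable (gauss_measure I \<sigma> m) (\<lambda>y. \<bar>y i - m i\<bar>)"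
    and "(\<integral>y. \<bar>y i - m i\<bar> \<partial>gauss_measure I \<sigma> m) \<le> \<sigma>"
proof -
  have int: "integrable lborel (\<lambda>t. normal_density (m i) \<sigma> t * \<bar>t - m i\<bar>)"
    using integrable_normal_moment_abs[OF assms(1), of "m i" 1] by simp
  note * = gauss_measure_integrable_component[of \<sigma> i I "\<lambda>t. \<bar>t - m i\<bar>" m, OF assms _ int]
  show "integrable (gauss_measure I \<sigma> m) (\<lambda>y. \<bar>y i - m i\<bar>)" by (rule *) simp
  \<comment> \<open>The exact mean absolute deviation is rounded up to \<sigma>, using that pi
    exceeds 2.\<close>
  have "(\<integral>y. \<bar>y i - m i\<bar> \<partial>gauss_measure I \<sigma> m) = \<sigma> * sqrt (2 / pi)"
    using integral_normal_moment_abs_odd[OF assms(1), of "m i" 0] by (subst *) auto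
  also have "\<dots> \<le> \<sigma> * 1"
    using assms pi_gt3 by (intro mult_left_mono) (auto simp: real_sqrt_le_1_iff)
  finally show "(\<integral>y. \<bar>y i - m i\<bar> \<partial>gauss_measure I \<sigma> m) \<le> \<sigma>" by simp
qed

text \<open>The log density is a quadratic polynomial in the coordinates, and second moments are
  finite under every Gaussian, whatever its mean.\<close>

lemma integrable_ln_gauss_density:
  assumes "finite I" "\<sigma> > 0"
  shows "integrable (gauss_measure I \<sigma> m) (\<lambda>y. ln (gauss_density I \<sigma> m' y))"
  unfolding ln_gauss_density[OF assms]
  using assms prob_space.finite_measure[OF prob_space_gauss_measure[OF assms(2)]]
  by (intro Bochner_Integration.integrable_diff integrable_divide_zero
      Bochner_Integration.integrable_sum gauss_measure_integrable_square
      finite_measure.integrable_const) auto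

lemma gauss_density_le:
  assumes "finite I" "\<sigma> > 0"
  shows "gauss_density I \<sigma> m y \<le> normal_density 0 \<sigma> 0 ^ card I"
proof -
  have "(\<Prod>i\<in>I. normal_density (m i) \<sigma> (y i)) \<le> (\<Prod>i\<in>I. normal_density 0 \<sigma> 0)"
  proof (rule prod_mono)
    fix i show "0 \<le> normal_density (m i) \<sigma> (y i) \<and> normal_density (m i) \<sigma> (y i) \<le> normal_density 0 \<sigma> 0"
      using \<open>\<sigma> > 0\<close> by (auto simp: normal_density_def intro!: mult_left_le divide_right_mono)
  qed
  then show ?thesis by (simp add: gauss_density_def)
qed

section \<open>Finite Gaussian mixtures and the cost of translating one coordinate\<close>

locale gaussian_mixture =
  fixes I :: "'i set" and A :: "'x set" and w :: "'x \<Rightarrow> real" and \<sigma> :: real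
  assumes finite_I: "finite I" and finite_A: "finite A" and w_pos: "\<And>x. x \<in> A \<Longrightarrow> w x > 0"
    and sum_w: "sum w A = 1" and \<sigma>_pos: "\<sigma> > 0"
begin

abbreviation "L \<equiv> PiM I (\<lambda>_. lborel :: real measure)"
abbreviation "dens \<equiv> gauss_density I \<sigma>"
abbreviation "Q \<equiv> gauss_measure I \<sigma>"

definition mix :: "('x \<Rightarrow> 'i \<Rightarrow> real) \<Rightarrow> ('i \<Rightarrow> real) \<Rightarrow> real" where
  "mix \<mu> y = (\<Sum>x\<in>A. w x * dens (\<mu> x) y)"

definition info :: "('x \<Rightarrow> 'i \<Rightarrow> real) \<Rightarrow> real" where
  "info \<mu> = (\<Sum>x\<in>A. w x * (\<integral>y. ln (dens (\<mu> x) y / mix \<mu> y) \<partial>Q (\<mu> x)))"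

lemma measurable_mix[measurable]: "mix \<mu> \<in> borel_measurable L"
  unfolding mix_def by measurable

lemma dens_pos: "dens m y > 0"
  by (rule gauss_density_pos[OF \<sigma>_pos])

lemma mix_ge: "x \<in> A \<Longrightarrow> w x * dens (\<mu> x) y \<le> mix \<mu> y"
  unfolding mix_def using w_pos dens_pos
  by (intro member_le_sum[where f = "\<lambda>x. w x * dens (\<mu> x) y"] finite_A) (auto simp: less_imp_le)

lemma A_nonempty: "A \<noteq> {}"
  using sum_w by auto

lemma mix_pos: "mix \<mu> y > 0"
  unfolding mix_def using w_pos dens_pos finite_A A_nonempty by (intro sum_pos mult_pos_pos)

lemma mix_le: "mix \<mu> y \<le> normal_density 0 \<sigma> 0 ^ card I"
proof -
  have "mix \<mu> y \<le> (\<Sum>x\<in>A. w x * normal_density 0 \<sigma> 0 ^ card I)"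
    unfolding mix_def using w_pos
    by (intro sum_mono mult_left_mono gauss_density_le finite_I \<sigma>_pos) (auto simp: less_imp_le)
  also have "\<dots> = normal_density 0 \<sigma> 0 ^ card I"
    by (simp add: sum_distrib_right[symmetric] sum_w)
  finally show ?thesis .
qed

lemma integrable_ln_dens: "integrable (Q m) (\<lambda>y. ln (dens m' y))"
  by (rule integrable_ln_gauss_density[OF finite_I \<sigma>_pos])

text \<open>The mixture lies between one of its weighted components and the peak value of a
  component, so its logarithm is controlled by a constant and the log density of that
  component.\<close>

lemma integrable_ln_mix: "integrable (Q m) (\<lambda>y. ln (mix \<mu> y))"
proof -
  obtain x where x: "x \<in> A" using A_nonempty by auto
  let ?C = "\<bar>ln (w x)\<bar> + \<bar>card I * ln (normal_density 0 \<sigma> 0)\<bar>"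
  have fin: "finite_measure (Q m)"
    by (rule prob_space.finite_measure[OF prob_space_gauss_measure[OF \<sigma>_pos]])
  show ?thesis
  proof (rule Bochner_Integration.integrable_bound)
    show "integrable (Q m) (\<lambda>y. ?C + \<bar>ln (dens (\<mu> x) y)\<bar>)"
      by (intro Bochner_Integration.integrable_add integrable_abs integrable_ln_dens
          finite_measure.integrable_const fin)
    show "AE y in Q m. norm (ln (mix \<mu> y)) \<le> norm (?C + \<bar>ln (dens (\<mu> x) y)\<bar>)"
    proof (rule AE_I2)
      fix y
      have "ln (w x * dens (\<mu> x) y) \<le> ln (mix \<mu> y)"
        using mix_ge[OF x, of \<mu> y] w_pos[OF x] dens_pos by (intro ln_mono) auto
      moreover have "ln (w x * dens (\<mu> x) y) = ln (w x) + ln (dens (\<mu> x) y)"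
        using w_pos[OF x] dens_pos by (intro ln_mult_pos) 
      moreover have "ln (mix \<mu> y) \<le> ln (normal_density 0 \<sigma> 0 ^ card I)"
        using mix_le mix_pos by (intro ln_mono) auto
      moreover have "ln (normal_density 0 \<sigma> 0 ^ card I) = card I * ln (normal_density 0 \<sigma> 0)"
        using normal_density_pos[OF \<sigma>_pos] by (intro ln_realpow)
      ultimately show "norm (ln (mix \<mu> y)) \<le> norm (?C + \<bar>ln (dens (\<mu> x) y)\<bar>)"
        by simp
    qed
  qed measurable
qed

lemma integrable_Q_iff:
  assumes [measurable]: "f \<in> borel_measurable L"
  shows "integrable (Q m) (f :: _ \<Rightarrow> real) \<longleftrightarrow> integrable L (\<lambda>y. dens m y * f y)"
  unfolding gauss_measure_eq_density[OF finite_I \<sigma>_pos]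
  by (subst integrable_density) (auto simp: dens_pos less_imp_le)

lemma integral_Q:
  assumes [measurable]: "f \<in> borel_measurable L"
  shows "(\<integral>y. f y \<partial>Q m :: real) = (\<integral>y. dens m y * f y \<partial>L)"
  unfolding gauss_measure_eq_density[OF finite_I \<sigma>_pos]
  by (subst integral_density) (auto simp: dens_pos less_imp_le)

text \<open>Averaging over the input and then over the output given the input is integration against
  the output density. Integrability under one component follows from \<open>dens\<close> being at
  most \<open>mix / w\<close>.\<close>

lemma mix_integral:
  assumes [measurable]: "f \<in> borel_measurable L" and int: "integrable L (\<lambda>y. mix \<mu> y * f y)"
  shows "\<And>x. x \<in> A \<Longrightarrow> integrable (Q (\<mu> x)) f"
    and "(\<Sum>x\<in>A. w x * (\<integral>y. f y \<partial>Q (\<mu> x))) = (\<integral>y. mix \<mu> y * f y \<partial>L)"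
proof -
  have I: "integrable L (\<lambda>y. dens (\<mu> x) y * f y)" if x: "x \<in> A" for x
  proof (rule Bochner_Integration.integrable_bound)
    show "integrable L (\<lambda>y. (mix \<mu> y * f y) / w x)"
      using int by simp
    show "AE y in L. norm (dens (\<mu> x) y * f y) \<le> norm (mix \<mu> y * f y / w x)"
    proof (rule AE_I2)
      fix y
      have "dens (\<mu> x) y \<le> mix \<mu> y / w x"
        using mix_ge[OF x, of \<mu> y] w_pos[OF x] by (simp add: field_simps)
      then have "dens (\<mu> x) y * \<bar>f y\<bar> \<le> mix \<mu> y / w x * \<bar>f y\<bar>" by (rule mult_right_mono) simp
      then show "norm (dens (\<mu> x) y * f y) \<le> norm (mix \<mu> y * f y / w x)"
        using dens_pos[of "\<mu> x" y] mix_pos[of \<mu> y] w_pos[OF x] by (simp add: abs_mult)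
    qed
  qed measurable
  then show "\<And>x. x \<in> A \<Longrightarrow> integrable (Q (\<mu> x)) f"
    by (subst integrable_Q_iff) auto
  have "(\<Sum>x\<in>A. w x * (\<integral>y. f y \<partial>Q (\<mu> x))) = (\<Sum>x\<in>A. \<integral>y. w x * (dens (\<mu> x) y * f y) \<partial>L)"
    by (simp add: integral_Q)
  also have "\<dots> = (\<integral>y. (\<Sum>x\<in>A. w x * (dens (\<mu> x) y * f y)) \<partial>L)"
    using I by (intro Bochner_Integration.integral_sum[symmetric]) auto
  also have "\<dots> = (\<integral>y. mix \<mu> y * f y \<partial>L)"
    by (simp add: mix_def sum_distrib_right mult.assoc)
  finally show "(\<Sum>x\<in>A. w x * (\<integral>y. f y \<partial>Q (\<mu> x))) = (\<integral>y. mix \<mu> y * f y \<partial>L)" .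
qed

lemma integrable_dens: "integrable L (dens m)" and integral_dens: "(\<integral>y. dens m y \<partial>L) = 1"
proof -
  interpret prob_space "Q m" by (rule prob_space_gauss_measure[OF \<sigma>_pos])
  show "integrable L (dens m)" using integrable_Q_iff[of "\<lambda>_. 1" m] by simp
  show "(\<integral>y. dens m y \<partial>L) = 1" using integral_Q[of "\<lambda>_. 1" m] by (simp add: prob_space)
qed

lemma integrable_mix: "integrable L (mix \<mu>)" and integral_mix: "(\<integral>y. mix \<mu> y \<partial>L) = 1"
  unfolding mix_def using integrable_dens
  by (auto simp: Bochner_Integration.integral_sum integral_dens sum_w)

text \<open>By \<open>mix_integral\<close> the left side is minus the relative entropy of
  \<open>mix \<mu>\<close> with respect to \<open>mix \<nu>\<close>. The bound is
  \<open>ln t <= t - 1\<close> at the ratio of the densities, whose integral vanishes since both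
  have mass 1.\<close>

lemma gibbs:
  "(\<Sum>x\<in>A. w x * (\<integral>y. ln (mix \<nu> y) - ln (mix \<mu> y) \<partial>Q (\<mu> x))) \<le> 0"
proof -
  have eq: "mix \<mu> y * (mix \<nu> y / mix \<mu> y - 1) = mix \<nu> y - mix \<mu> y" for y
    using mix_pos[of \<mu> y] by (simp add: field_simps)
  have int: "integrable L (\<lambda>y. mix \<mu> y * (mix \<nu> y / mix \<mu> y - 1))"
    unfolding eq by (intro Bochner_Integration.integrable_diff integrable_mix)
  note I = mix_integral[OF _ int]
  have "(\<Sum>x\<in>A. w x * (\<integral>y. ln (mix \<nu> y) - ln (mix \<mu> y) \<partial>Q (\<mu> x))) \<le>
      (\<Sum>x\<in>A. w x * (\<integral>y. mix \<nu> y / mix \<mu> y - 1 \<partial>Q (\<mu> x)))"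
  proof (intro sum_mono mult_left_mono integral_mono)
    fix x y assume "x \<in> A"
    show "ln (mix \<nu> y) - ln (mix \<mu> y) \<le> mix \<nu> y / mix \<mu> y - 1"
      using mix_pos[of \<mu> y] mix_pos[of \<nu> y] ln_le_minus_one[of "mix \<nu> y / mix \<mu> y"]
      by (simp add: ln_div)
  qed (auto intro!: I integrable_ln_mix less_imp_le w_pos)
  also have "\<dots> = (\<integral>y. mix \<mu> y * (mix \<nu> y / mix \<mu> y - 1) \<partial>L)"
    by (rule I) measurable
  also have "\<dots> = 0"
    unfolding eq by (simp add: integrable_mix integral_mix)
  finally show ?thesis .
qed

text \<open>The posterior mean of the noise amplitude in coordinate \<open>i\<close>, given the output \<open>y\<close>.\<close>

definition noise :: "('x \<Rightarrow> 'i \<Rightarrow> real) \<Rightarrow> 'i \<Rightarrow> ('i \<Rightarrow> real) \<Rightarrow> real" where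
  "noise \<mu> i y = (\<Sum>x\<in>A. w x * dens (\<mu> x) y * \<bar>y i - \<mu> x i\<bar>) / mix \<mu> y"

text \<open>Translating \<open>y i\<close> multiplies each component by an exponential factor.
  Jensen's inequality under the posterior weights of the components bounds the resulting average
  from below, and the posterior mean of the absolute noise is \<open>noise\<close>.\<close>

lemma ln_mix_shift:
  assumes i: "i \<in> I" and u: "\<bar>u\<bar> \<le> h"
  shows "ln (mix \<mu> y) - (h * noise \<mu> i y + h\<^sup>2 / 2) / \<sigma>\<^sup>2 \<le> ln (mix \<mu> (y(i := y i + u)))"
proof -
  let ?R = "(h * noise \<mu> i y + h\<^sup>2 / 2) / \<sigma>\<^sup>2"
  let ?r = "\<lambda>x. (h * \<bar>y i - \<mu> x i\<bar> + h\<^sup>2 / 2) / \<sigma>\<^sup>2"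
  let ?g = "\<lambda>x. w x * dens (\<mu> x) y"
  have g: "?g x > 0" if "x \<in> A" for x using w_pos[OF that] dens_pos by simp
  have \<sigma>2: "\<sigma>\<^sup>2 > 0" using \<sigma>_pos by simp
  \<comment> \<open>\<open>?r x\<close> bounds the exponent lost by component \<open>x\<close>, and
    \<open>?R\<close> is its posterior mean.\<close>
  have sum_r: "(\<Sum>x\<in>A. ?g x * ?r x) = mix \<mu> y * ?R"
  proof -
    have "(\<Sum>x\<in>A. ?g x * ?r x) =
        (h * (\<Sum>x\<in>A. ?g x * \<bar>y i - \<mu> x i\<bar>) + h\<^sup>2 / 2 * (\<Sum>x\<in>A. ?g x)) / \<sigma>\<^sup>2"
      unfolding sum_distrib_left sum.distrib[symmetric] sum_divide_distrib
      by (intro sum.cong refl) (simp add: algebra_simps add_divide_distrib)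
    also have "\<dots> = (h * (mix \<mu> y * noise \<mu> i y) + h\<^sup>2 / 2 * mix \<mu> y) / \<sigma>\<^sup>2"
      using mix_pos[of \<mu> y] unfolding noise_def mix_def[symmetric] by simp
    also have "\<dots> = mix \<mu> y * ?R"
      by (simp add: algebra_simps add_divide_distrib)
    finally show ?thesis .
  qed
  \<comment> \<open>By \<open>sum_r\<close> the added terms cancel; they turn each summand into the
    tangent line of \<open>exp\<close> at \<open>- ?R\<close>, evaluated at
    \<open>- ?r x\<close>.\<close>
  have "exp (- ?R) * mix \<mu> y = exp (- ?R) * ((1 + ?R) * mix \<mu> y - (\<Sum>x\<in>A. ?g x * ?r x))"
    unfolding sum_r by (simp add: algebra_simps)
  also have "\<dots> = (\<Sum>x\<in>A. ?g x * (exp (- ?R) * (1 + (?R - ?r x))))"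
    unfolding mix_def sum_distrib_left sum_subtractf[symmetric]
    by (intro sum.cong refl) (simp only: algebra_simps)
  also have "\<dots> \<le> (\<Sum>x\<in>A. ?g x * exp (- (2 * u * (y i - \<mu> x i) + u\<^sup>2) / (2 * \<sigma>\<^sup>2)))"
  proof (intro sum_mono mult_left_mono)
    fix x assume x: "x \<in> A"
    have "exp (- ?R) * (1 + (?R - ?r x)) \<le> exp (- ?R) * exp (?R - ?r x)"
      by (intro mult_left_mono exp_ge_add_one_self) auto
    also have "\<dots> = exp (- ?r x)" by (simp add: exp_add[symmetric])
    also have "\<dots> \<le> exp (- (2 * u * (y i - \<mu> x i) + u\<^sup>2) / (2 * \<sigma>\<^sup>2))"
    proof -
      have "u * (y i - \<mu> x i) \<le> \<bar>u\<bar> * \<bar>y i - \<mu> x i\<bar>"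
        by (metis abs_ge_self abs_mult)
      also have "\<dots> \<le> h * \<bar>y i - \<mu> x i\<bar>" using u by (intro mult_right_mono) auto
      finally have "u * (y i - \<mu> x i) \<le> h * \<bar>y i - \<mu> x i\<bar>" .
      moreover have "u\<^sup>2 \<le> h\<^sup>2" using u by (simp add: abs_le_square_iff[symmetric])
      ultimately have "2 * u * (y i - \<mu> x i) + u\<^sup>2 \<le> 2 * (h * \<bar>y i - \<mu> x i\<bar> + h\<^sup>2 / 2)" by simp
      then have "(2 * u * (y i - \<mu> x i) + u\<^sup>2) / (2 * \<sigma>\<^sup>2) \<le> 2 * (h * \<bar>y i - \<mu> x i\<bar> + h\<^sup>2 / 2) / (2 * \<sigma>\<^sup>2)"
        using \<sigma>2 by (intro divide_right_mono) auto
      also have "\<dots> = ?r x" by (rule mult_divide_mult_cancel_left) simp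
      finally show ?thesis unfolding minus_divide_left[symmetric] exp_le_cancel_iff by (rule le_imp_neg_le)
    qed
    finally show "exp (- ?R) * (1 + (?R - ?r x)) \<le> \<dots>" .
  qed (use g in \<open>auto simp: less_imp_le\<close>)
  also have "\<dots> = mix \<mu> (y(i := y i + u))"
    unfolding mix_def by (simp add: gauss_density_shift[OF finite_I i \<sigma>_pos] mult.assoc)
  finally have le: "exp (- ?R) * mix \<mu> y \<le> mix \<mu> (y(i := y i + u))" .
  have "ln (exp (- ?R) * mix \<mu> y) = - ?R + ln (mix \<mu> y)"
    using mix_pos[of \<mu> y] by (subst ln_mult_pos) auto
  moreover have "ln (exp (- ?R) * mix \<mu> y) \<le> ln (mix \<mu> (y(i := y i + u)))"
    using le mix_pos[of \<mu> y] by (intro ln_mono) auto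
  ultimately show ?thesis by simp
qed

lemma measurable_noise[measurable]: "i \<in> I \<Longrightarrow> noise \<mu> i \<in> borel_measurable L"
  unfolding noise_def by measurable

text \<open>The tower property: averaging the posterior mean over the output gives back the prior
  mean of the absolute noise, which is at most \<sigma>. The denominator in \<open>noise\<close>
  cancels against the output density.\<close>

lemma noise_integral:
  assumes i: "i \<in> I"
  shows "\<And>x. x \<in> A \<Longrightarrow> integrable (Q (\<mu> x)) (noise \<mu> i)"
    and "(\<Sum>x\<in>A. w x * (\<integral>y. noise \<mu> i y \<partial>Q (\<mu> x))) \<le> \<sigma>"
proof -
  note [measurable] = i
  have eq: "mix \<mu> y * noise \<mu> i y = (\<Sum>x\<in>A. w x * (dens (\<mu> x) y * \<bar>y i - \<mu> x i\<bar>))" for y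
    using mix_pos[of \<mu> y] by (simp add: noise_def mult.assoc)
  have 1: "integrable L (\<lambda>y. dens m y * \<bar>y i - m i\<bar>)" for m
    using gauss_measure_abs_moment(1)[OF \<sigma>_pos i] by (subst (asm) integrable_Q_iff) auto
  have int: "integrable L (\<lambda>y. mix \<mu> y * noise \<mu> i y)"
    unfolding eq using 1 by (intro Bochner_Integration.integrable_sum) auto
  note I = mix_integral[OF measurable_noise[OF i] int]
  show "\<And>x. x \<in> A \<Longrightarrow> integrable (Q (\<mu> x)) (noise \<mu> i)" by (rule I)
  have "(\<Sum>x\<in>A. w x * (\<integral>y. noise \<mu> i y \<partial>Q (\<mu> x))) = (\<Sum>x\<in>A. w x * (\<integral>y. dens (\<mu> x) y * \<bar>y i - \<mu> x i\<bar> \<partial>L))"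
    unfolding I(2) eq using 1 by (subst Bochner_Integration.integral_sum) auto
  also have "\<dots> = (\<Sum>x\<in>A. w x * (\<integral>y. \<bar>y i - \<mu> x i\<bar> \<partial>Q (\<mu> x)))"
    by (subst integral_Q) auto
  also have "\<dots> \<le> (\<Sum>x\<in>A. w x * \<sigma>)"
    by (intro sum_mono mult_left_mono gauss_measure_abs_moment \<sigma>_pos i less_imp_le w_pos)
  also have "\<dots> = \<sigma>" by (simp add: sum_distrib_right[symmetric] sum_w)
  finally show "(\<Sum>x\<in>A. w x * (\<integral>y. noise \<mu> i y \<partial>Q (\<mu> x))) \<le> \<sigma>" .
qed

lemma info_eq:
  "info \<mu> = (\<Sum>x\<in>A. w x * (\<integral>y. ln (dens (\<mu> x) y) - ln (mix \<mu> y) \<partial>Q (\<mu> x)))"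
  unfolding info_def using dens_pos mix_pos by (simp add: ln_divide_pos)

text \<open>Replacing the output density of \<open>\<nu>\<close> by that of \<open>\<mu>\<close> only increases the divergence; the
  translation carrying \<open>\<nu> x\<close> to \<open>\<mu> x\<close> then reduces everything to \<open>ln_mix_shift\<close>.\<close>

lemma info_shift_le:
  assumes i: "i \<in> I" and u: "\<And>x. x \<in> A \<Longrightarrow> \<bar>u x\<bar> \<le> h" and h: "h \<ge> 0"
    and \<nu>: "\<And>x. x \<in> A \<Longrightarrow> \<nu> x = (\<mu> x)(i := \<mu> x i + u x)"
  shows "info \<nu> \<le> info \<mu> + h / \<sigma> + h\<^sup>2 / (2 * \<sigma>\<^sup>2)"
proof -
  note [measurable] = i
  let ?S = "\<lambda>x y. y(i := y i + u x)"
  have "info \<nu> = (\<Sum>x\<in>A. w x * (\<integral>y. ln (dens (\<nu> x) y) - ln (mix \<mu> y) \<partial>Q (\<nu> x))) +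
      (\<Sum>x\<in>A. w x * (\<integral>y. ln (mix \<mu> y) - ln (mix \<nu> y) \<partial>Q (\<nu> x)))"
    unfolding info_eq sum.distrib[symmetric] distrib_left[symmetric]
    by (intro sum.cong refl arg_cong2[where f = "(*)"], subst Bochner_Integration.integral_add[symmetric])
       (auto intro!: integrable_ln_dens integrable_ln_mix)
  also have "\<dots> \<le> (\<Sum>x\<in>A. w x * (\<integral>y. ln (dens (\<nu> x) y) - ln (mix \<mu> y) \<partial>Q (\<nu> x)))"
    using gibbs[of \<nu> \<mu>] by simp
  \<comment> \<open>Undoing the translation restores both the measure and the log density of
    component \<open>x\<close>; only the argument of \<open>mix \<mu>\<close> remains
    shifted.\<close>
  also have "\<dots> = (\<Sum>x\<in>A. w x * (\<integral>y. ln (dens (\<mu> x) y) - ln (mix \<mu> (?S x y)) \<partial>Q (\<mu> x)))"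
  proof (intro sum.cong refl arg_cong2[where f = "(*)"])
    fix x assume x: "x \<in> A"
    have "(\<integral>y. ln (dens (\<nu> x) y) - ln (mix \<mu> y) \<partial>Q (\<nu> x)) =
        (\<integral>y. ln (dens (\<nu> x) y) - ln (mix \<mu> y) \<partial>distr (Q (\<mu> x)) L (?S x))"
      by (simp add: distr_shift_gauss_measure[OF finite_I \<sigma>_pos i] \<nu>[OF x])
    also have "\<dots> = (\<integral>y. ln (dens (\<nu> x) (?S x y)) - ln (mix \<mu> (?S x y)) \<partial>Q (\<mu> x))"
      by (rule integral_distr) measurable
    finally show "(\<integral>y. ln (dens (\<nu> x) y) - ln (mix \<mu> y) \<partial>Q (\<nu> x)) =
        (\<integral>y. ln (dens (\<mu> x) y) - ln (mix \<mu> (?S x y)) \<partial>Q (\<mu> x))"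
      by (simp add: \<nu>[OF x] gauss_density_shift_both)
  qed
  also have "\<dots> \<le> (\<Sum>x\<in>A. w x * ((\<integral>y. ln (dens (\<mu> x) y) - ln (mix \<mu> y) \<partial>Q (\<mu> x)) +
      h / \<sigma>\<^sup>2 * (\<integral>y. noise \<mu> i y \<partial>Q (\<mu> x)) + h\<^sup>2 / (2 * \<sigma>\<^sup>2)))"
  proof (intro sum_mono mult_left_mono)
    fix x assume x: "x \<in> A"
    interpret prob_space "Q (\<mu> x)" by (rule prob_space_gauss_measure[OF \<sigma>_pos])
    have "integrable (distr (Q (\<mu> x)) L (?S x)) (\<lambda>y. ln (mix \<mu> y))"
      unfolding distr_shift_gauss_measure[OF finite_I \<sigma>_pos i] by (rule integrable_ln_mix)
    then have int1: "integrable (Q (\<mu> x)) (\<lambda>y. ln (mix \<mu> (?S x y)))"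
      by (subst (asm) integrable_distr_eq) measurable
    note int2 = noise_integral(1)[OF i x]
    have "(\<integral>y. ln (dens (\<mu> x) y) - ln (mix \<mu> (?S x y)) \<partial>Q (\<mu> x)) \<le>
      (\<integral>y. (ln (dens (\<mu> x) y) - ln (mix \<mu> y)) + h / \<sigma>\<^sup>2 * noise \<mu> i y + h\<^sup>2 / (2 * \<sigma>\<^sup>2) \<partial>Q (\<mu> x))"
    proof (rule integral_mono)
      fix y
      show "ln (dens (\<mu> x) y) - ln (mix \<mu> (?S x y)) \<le>
          (ln (dens (\<mu> x) y) - ln (mix \<mu> y)) + h / \<sigma>\<^sup>2 * noise \<mu> i y + h\<^sup>2 / (2 * \<sigma>\<^sup>2)"
        using ln_mix_shift[OF i u[OF x], of \<mu> y] by (simp add: add_divide_distrib)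
    qed (intro Bochner_Integration.integrable_add Bochner_Integration.integrable_diff
        integrable_mult_right integrable_const int1 int2 integrable_ln_dens integrable_ln_mix)+
    also have "\<dots> = (\<integral>y. ln (dens (\<mu> x) y) - ln (mix \<mu> y) \<partial>Q (\<mu> x)) +
        h / \<sigma>\<^sup>2 * (\<integral>y. noise \<mu> i y \<partial>Q (\<mu> x)) + h\<^sup>2 / (2 * \<sigma>\<^sup>2)"
      using int2 integrable_ln_dens integrable_ln_mix by (simp add: prob_space)
    finally show "(\<integral>y. ln (dens (\<mu> x) y) - ln (mix \<mu> (?S x y)) \<partial>Q (\<mu> x)) \<le> \<dots>" .
  qed (auto intro: less_imp_le w_pos)
  also have "\<dots> = info \<mu> + h / \<sigma>\<^sup>2 * (\<Sum>x\<in>A. w x * (\<integral>y. noise \<mu> i y \<partial>Q (\<mu> x))) + h\<^sup>2 / (2 * \<sigma>\<^sup>2) * sum w A"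
    unfolding info_eq sum_distrib_left sum.distrib[symmetric]
    by (intro sum.cong refl) (simp only: algebra_simps)
  also have "\<dots> \<le> info \<mu> + h / \<sigma>\<^sup>2 * \<sigma> + h\<^sup>2 / (2 * \<sigma>\<^sup>2) * sum w A"
    using noise_integral(2)[OF i, of \<mu>] h by (intro add_mono mult_left_mono order_refl) auto
  also have "h / \<sigma>\<^sup>2 * \<sigma> = h / \<sigma>" using \<sigma>_pos by (simp add: power2_eq_square)
  finally show ?thesis by (simp add: sum_w)
qed

end

text \<open>The way from \<open>b\<close> to \<open>a\<close> is cut into \<open>Suc n\<close> equal
  steps. The linear costs add up to the same total, while the quadratic ones sum to a term of order
  \<open>1 / Suc n\<close>, which vanishes in the limit.\<close>

lemma lipschitz_of_quadratic_error:
  fixes f :: "real \<Rightarrow> real"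
  assumes f: "\<And>a b. f a \<le> f b + c * \<bar>a - b\<bar> + d * (a - b)\<^sup>2"
  shows "\<bar>f a - f b\<bar> \<le> c * \<bar>a - b\<bar>"
proof -
  have le: "f a \<le> f b + c * \<bar>a - b\<bar>" for a b
  proof -
    have step: "f a \<le> f b + c * \<bar>a - b\<bar> + d * (a - b)\<^sup>2 / Suc n" for n
    proof -
      define D where "D = (a - b) / Suc n"
      define p where "p k = b + real k * D" for k
      have "f (p k) \<le> f b + k * (c * \<bar>D\<bar> + d * D\<^sup>2)" for k
      proof (induction k)
        case (Suc k)
        have "p (Suc k) - p k = D" by (simp add: p_def algebra_simps)
        with f[of "p (Suc k)" "p k"] Suc show ?case by (simp add: algebra_simps)
      qed (simp add: p_def)
      from this[of "Suc n"]
      have "f a \<le> f b + Suc n * (c * (\<bar>a - b\<bar> / Suc n) + d * ((a - b)\<^sup>2 / (Suc n)\<^sup>2))"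
        by (simp add: p_def D_def abs_divide power_divide del: of_nat_Suc)
      also have "\<dots> = f b + c * \<bar>a - b\<bar> + d * (a - b)\<^sup>2 / Suc n"
      proof -
        have "N * (c * (x / N) + d * (z / N\<^sup>2)) = c * x + d * z / N" if "N > 0" for N x z :: real
          using that by (simp add: field_simps power2_eq_square)
        then show ?thesis by (simp del: of_nat_Suc)
      qed
      finally show ?thesis .
    qed
    have "(\<lambda>n. f b + c * \<bar>a - b\<bar> + d * (a - b)\<^sup>2 / Suc n) \<longlonglongrightarrow> f b + c * \<bar>a - b\<bar> + 0"
      by (intro tendsto_add tendsto_const) (rule LIMSEQ_Suc[OF lim_const_over_n])
    then show ?thesis using step by (auto intro!: LIMSEQ_le_const)
  qed
  show ?thesis using le[of a b] le[of b a] by (simp add: abs_le_iff abs_minus_commute)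
qed

section \<open>The binary-input CDMA channel\<close>

lemma finite_sign_vectors: "finite (sign_vectors K)"
  unfolding sign_vectors_def by (intro finite_PiE) auto

definition cdma_mean :: "nat \<Rightarrow> nat \<Rightarrow> (nat \<times> nat \<Rightarrow> real) \<Rightarrow> (nat \<Rightarrow> real) \<Rightarrow> nat \<Rightarrow> real" where
  "cdma_mean N K s x i = (\<Sum>k<K. s (i, k) * x k) / sqrt (real N)"

text \<open>One spreading coefficient enters only the mean of chip \<open>i\<close>, so changing it
  is a translation of one coordinate, as \<open>info_shift_le\<close> requires.\<close>

lemma cdma_mean_upd:
  assumes "k < K"
  shows "cdma_mean N K (s((i, k) := a)) x =
    (cdma_mean N K (s((i, k) := b)) x)(i := cdma_mean N K (s((i, k) := b)) x i + (a - b) * x k / sqrt N)"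
proof
  fix j
  have "(\<Sum>l<K. (s((i, k) := a)) (i, l) * x l) =
      a * x k + (\<Sum>l\<in>{..<K} - {k}. s (i, l) * x l)" for a
    using assms by (subst sum.remove[of _ k]) (auto intro!: sum.cong)
  then show "cdma_mean N K (s((i, k) := a)) x j =
    ((cdma_mean N K (s((i, k) := b)) x)(i := cdma_mean N K (s((i, k) := b)) x i + (a - b) * x k / sqrt N)) j"
    by (cases "j = i") (simp_all add: cdma_mean_def add_divide_distrib[symmetric] algebra_simps)
qed

context
  fixes \<sigma> :: real and N K :: nat and pX :: "(nat \<Rightarrow> real) pmf"
  assumes \<sigma>_pos: "\<sigma> > 0" and pX: "set_pmf pX \<subseteq> sign_vectors K"
begin

lemma finite_set_pX: "finite (set_pmf pX)"
  using pX finite_sign_vectors by (rule finite_subset)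

text \<open>The support of the input distribution serves as index set: it is finite, and all weights
  on it are strictly positive.\<close>

interpretation gaussian_mixture "{..<N}" "set_pmf pX" "pmf pX" \<sigma>
  by unfold_locales (auto simp: finite_set_pX \<sigma>_pos pmf_positive sum_pmf_eq_1)

lemma cdma_cond_density_eq: "cdma_cond_density \<sigma> N K s x y = dens (cdma_mean N K s x) y"
  by (simp add: cdma_cond_density_def gauss_density_def cdma_mean_def)

lemma cdma_out_density_eq: "cdma_out_density \<sigma> N K s pX y = mix (cdma_mean N K s) y"
  unfolding cdma_out_density_def mix_def cdma_cond_density_eq
  by (subst integral_measure_pmf[OF finite_set_pX]) auto

lemma cdma_mutual_info_eq: "cdma_mutual_info \<sigma> N K s pX = info (cdma_mean N K s)"
  unfolding cdma_mutual_info_def cdma_cond_density_eq cdma_out_density_eq output_space_def info_def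
  by (subst integral_measure_pmf[OF finite_set_pX]) (auto simp: integral_Q)

text \<open>A finite sum of integrals over \<open>y\<close> of integrands that are jointly
  measurable in the spreading matrix and the output; the output space is sigma-finite.\<close>

lemma measurable_cdma_mutual_info:
  "(\<lambda>s. cdma_mutual_info \<sigma> N K s pX) \<in> borel_measurable (PiM ({..<N} \<times> {..<K}) (\<lambda>_. std_normal))"
proof -
  let ?S = "PiM ({..<N} \<times> {..<K}) (\<lambda>_. std_normal)"
  interpret Lp: product_sigma_finite "\<lambda>_. lborel :: real measure" by unfold_locales
  interpret L: sigma_finite_measure L by (rule Lp.sigma_finite) simp
  have comp: "(\<lambda>p. fst p (i, k)) \<in> borel_measurable (?S \<Otimes>\<^sub>M L)" if "i < N" "k < K" for i k
  proof -
    have "(\<lambda>s. s (i, k)) \<in> measurable ?S std_normal"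
      using that by (intro measurable_component_singleton) auto
    then show ?thesis by simp
  qed
  have comp': "(\<lambda>p. snd p i) \<in> borel_measurable (?S \<Otimes>\<^sub>M L)" if "i < N" for i
  proof -
    have "(\<lambda>y. y i) \<in> measurable L lborel"
      using that by (intro measurable_component_singleton) auto
    then show ?thesis by simp
  qed
  have d[measurable]: "(\<lambda>p. cdma_cond_density \<sigma> N K (fst p) x (snd p)) \<in> borel_measurable (?S \<Otimes>\<^sub>M L)" for x
    unfolding cdma_cond_density_def normal_density_def
    by (intro borel_measurable_prod borel_measurable_times borel_measurable_divide borel_measurable_sum
        borel_measurable_exp borel_measurable_uminus borel_measurable_power borel_measurable_diff
        borel_measurable_const comp comp' borel_measurable_root) (auto intro: comp comp')
  have "(\<lambda>s. cdma_mutual_info \<sigma> N K s pX) = (\<lambda>s. \<Sum>x\<in>set_pmf pX. pmf pX x *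
      (\<integral>y. cdma_cond_density \<sigma> N K s x y * ln (cdma_cond_density \<sigma> N K s x y /
         (\<Sum>x'\<in>set_pmf pX. pmf pX x' * cdma_cond_density \<sigma> N K s x' y)) \<partial>L))"
    by (rule ext) (simp add: cdma_mutual_info_def cdma_out_density_def output_space_def
        integral_measure_pmf[OF finite_set_pX])
  also have "\<dots> \<in> borel_measurable ?S"
    by (intro borel_measurable_sum borel_measurable_times borel_measurable_const
        L.borel_measurable_lebesgue_integral) (simp add: case_prod_beta)
  finally show ?thesis .
qed

lemma coord_lipschitz_cdma_mutual_info:
  assumes "N > 0"
  shows "coord_lipschitz ({..<N} \<times> {..<K}) (1 / (\<sigma> * sqrt N)) (\<lambda>s. cdma_mutual_info \<sigma> N K s pX)"
  unfolding coord_lipschitz_def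
proof (intro ballI allI)
  fix s :: "nat \<times> nat \<Rightarrow> real" and p and a b :: real
  assume "p \<in> {..<N} \<times> {..<K}"
  then obtain i k where p: "p = (i, k)" "i < N" "k < K" by auto
  show "\<bar>cdma_mutual_info \<sigma> N K (s(p := a)) pX - cdma_mutual_info \<sigma> N K (s(p := b)) pX\<bar>
      \<le> 1 / (\<sigma> * sqrt N) * \<bar>a - b\<bar>"
    unfolding cdma_mutual_info_eq
  proof (rule lipschitz_of_quadratic_error)
    fix a b :: real
    \<comment> \<open>Binary inputs make the translation equally large for all input vectors, namely
      \<open>\<bar>a - b\<bar> / sqrt N\<close>.\<close>
    have x: "\<bar>x k\<bar> = 1" if "x \<in> set_pmf pX" for x
      using pX that p(3) by (force simp: sign_vectors_def PiE_iff)
    have "info (cdma_mean N K (s(p := a))) \<le> info (cdma_mean N K (s(p := b))) +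
        \<bar>a - b\<bar> / sqrt N / \<sigma> + (\<bar>a - b\<bar> / sqrt N)\<^sup>2 / (2 * \<sigma>\<^sup>2)"
    proof (rule info_shift_le[of i])
      show "cdma_mean N K (s(p := a)) x = (cdma_mean N K (s(p := b)) x)
          (i := cdma_mean N K (s(p := b)) x i + (a - b) * x k / sqrt N)" for x
        unfolding p by (rule cdma_mean_upd) fact
    qed (use p x in \<open>auto simp: abs_mult\<close>)
    also have "\<dots> = info (cdma_mean N K (s(p := b))) + 1 / (\<sigma> * sqrt N) * \<bar>a - b\<bar> +
        1 / (2 * \<sigma>\<^sup>2 * N) * (a - b)\<^sup>2"
      by (simp add: power_divide mult.commute)
    finally show "info (cdma_mean N K (s(p := a))) \<le> \<dots>" .
  qed
qed

end

theorem theorem1: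
  fixes \<beta> \<sigma> :: real
  assumes "\<beta> > 0" and "\<sigma> > 0"
  shows "\<exists>K1 :: real \<Rightarrow> nat.
           (\<lambda>\<epsilon>. real (K1 \<epsilon>)) \<in> O[at_right 0](\<lambda>\<epsilon>. \<bar>ln \<epsilon>\<bar>) \<and>
           (\<forall>\<epsilon>>0. \<forall>K N :: nat. K > K1 \<epsilon> \<and> real K = \<beta> * real N \<longrightarrow>
              (\<forall>pX :: (nat \<Rightarrow> real) pmf. set_pmf pX \<subseteq> sign_vectors K \<longrightarrow>
                 (let M = spreading_measure N K;
                      I = (\<lambda>s. cdma_mutual_info \<sigma> N K s pX);
                      EI = (\<integral>s. I s \<partial>M)
                  in measure M {s \<in> space M. \<bar>I s - EI\<bar> \<ge> \<epsilon> * real K}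
                     \<le> 3 * exp (- (1/16 * \<sigma>^4 / (64 * \<beta> + 32 + \<sigma>^2)) * \<epsilon>^2 * real K))))"
proof (intro exI[of _ "\<lambda>_. 0 :: nat"] conjI allI impI)
  show "(\<lambda>\<epsilon>. real 0) \<in> O[at_right 0](\<lambda>\<epsilon>. \<bar>ln \<epsilon>\<bar>)" by simp
next
  fix \<epsilon> :: real and K N :: nat and pX :: "(nat \<Rightarrow> real) pmf"
  assume \<epsilon>: "\<epsilon> > 0" and K: "0 < K \<and> real K = \<beta> * real N" and pX: "set_pmf pX \<subseteq> sign_vectors K"
  have N: "N > 0" using K by (cases N) auto
  \<comment> \<open>There are \<open>N * K\<close> coefficients, each with squared Lipschitz
    constant \<open>1 / (\<sigma>\<^sup>2 * N)\<close>.\<close>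
  let ?V = "real K / \<sigma>\<^sup>2"
  have V: "(1 / (\<sigma> * sqrt N))\<^sup>2 * card ({..<N} \<times> {..<K}) \<le> ?V"
    using N \<open>\<sigma> > 0\<close> by (simp add: power_divide power_mult_distrib)
  have V0: "?V > 0" and t: "\<epsilon> * real K > 0" using K \<epsilon> \<open>\<sigma> > 0\<close> by auto
  \<comment> \<open>The required rate is \<open>\<sigma>\<^sup>2 / 16\<close> times a ratio of at
    most 1, hence below the rate \<open>\<sigma>\<^sup>2 / 4\<close> supplied by the concentration
    bound.\<close>
  have "1/16 * \<sigma>^4 / (64 * \<beta> + 32 + \<sigma>\<^sup>2) \<le> \<sigma>\<^sup>2 / 4"
  proof -
    define D where "D = 64 * \<beta> + 32 + \<sigma>\<^sup>2"
    have D: "D > 0" "\<sigma>\<^sup>2 \<le> D" using \<open>\<beta> > 0\<close> by (auto simp: D_def add_pos_nonneg)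
    have "1/16 * \<sigma>^4 / D = \<sigma>\<^sup>2 / 16 * (\<sigma>\<^sup>2 / D)" by (simp add: power2_eq_square power4_eq_xxxx)
    also have "\<dots> \<le> \<sigma>\<^sup>2 / 16 * 1" using D by (intro mult_left_mono) auto
    finally show ?thesis unfolding D_def using zero_le_power2[of \<sigma>] by linarith
  qed
  then have "1/16 * \<sigma>^4 / (64 * \<beta> + 32 + \<sigma>\<^sup>2) * (\<epsilon>\<^sup>2 * K) \<le> \<sigma>\<^sup>2 / 4 * (\<epsilon>\<^sup>2 * K)"
    by (rule mult_right_mono) simp
  moreover have "(\<epsilon> * K)\<^sup>2 / (4 * ?V) = \<sigma>\<^sup>2 / 4 * (\<epsilon>\<^sup>2 * K)"
    using K \<open>\<sigma> > 0\<close> by (simp add: power2_eq_square field_simps)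
  ultimately have e: "- (\<epsilon> * K)\<^sup>2 / (4 * ?V) \<le> - (1/16 * \<sigma>^4 / (64 * \<beta> + 32 + \<sigma>\<^sup>2)) * \<epsilon>\<^sup>2 * K"
    by (simp only: minus_divide_left[symmetric] minus_mult_left[symmetric] neg_le_iff_le mult.assoc)
  have "2 * exp (- (\<epsilon> * K)\<^sup>2 / (4 * ?V)) \<le>
      3 * exp (- (1/16 * \<sigma>^4 / (64 * \<beta> + 32 + \<sigma>\<^sup>2)) * \<epsilon>\<^sup>2 * K)"
    by (rule mult_mono) (use e in auto)
  with coord_lipschitz_concentration[OF _ measurable_cdma_mutual_info[OF \<open>\<sigma> > 0\<close> pX]
      coord_lipschitz_cdma_mutual_info[OF \<open>\<sigma> > 0\<close> pX N] V V0 t]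
  show "let M = spreading_measure N K;
            I = (\<lambda>s. cdma_mutual_info \<sigma> N K s pX);
            EI = (\<integral>s. I s \<partial>M)
        in measure M {s \<in> space M. \<bar>I s - EI\<bar> \<ge> \<epsilon> * real K}
           \<le> 3 * exp (- (1/16 * \<sigma>^4 / (64 * \<beta> + 32 + \<sigma>^2)) * \<epsilon>^2 * real K)"
    unfolding Let_def spreading_measure_def by simp
qed

end
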